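(* Let $T$ be an order-preserving and positively homogeneous self-map of the interior of a symmetric cone $C$, and let $$\overline{\rho}(T):=\inf_{y\in\operatorname{int}C}\operatorname{RFunk}(y,T(y)).$$ Then, for all $x\in\operatorname{int}C$, $$\overline{\rho}(T)=\rho(T):=\lim_{k\to\infty}\frac{\operatorname{RFunk}(x,T^k(x))}{k},$$ and there exists an extreme ray of $C$ such that, for any (non-zero) element $w$ in this ray and all $k\in\mathbb{N}$, $$\log\langle w,T^k(x)\rangle\geq\log\langle w,x\rangle+k\,\overline{\rho}(T).$$
   Context: A symmetric cone is a closed, convex, pointed cone $C$ with non-empty interior in a finite-dimensional Euclidean space with scalar product $\langle\cdot,\cdot\rangle$, which is self-dual ($C=C^\star=\{z\mid\langle z,y\rangle\geq0\ \forall y\in C\}$) and such that the group of linear automorphisms of the space leaving $\operatorname{int}C$ invariant acts transitively on $\operatorname{int}C$. The partial order is $x\leq y$ iff $y-x\in C$. $T:\operatorname{int}C\to\operatorname{int}C$ is order-preserving if $x\leq y$ implies $T(x)\leq T(y)$, and positively homogeneous if $T(\lambda x)=\lambda T(x)$ for all $\lambda>0$. For $x,y\in\operatorname{int}C$, $\operatorname{RFunk}(x,y):=\log M(y/x)$ with $M(y/x):=\inf\{\lambda>0\mid\lambda x\geq y\}$ (the reverse Funk hemi-metric). *)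

theory Defs
  imports "HOL-Analysis.Analysis"
begin

definition dual_cone :: "'a::real_inner set \<Rightarrow> 'a set" where
  "dual_cone C = {z. \<forall>y\<in>C. 0 \<le> z \<bullet> y}"

text \<open>Membership in the group of linear automorphisms means that both the map and its
  inverse leave the interior invariant, hence the equality of the image with the interior.\<close>

definition cone_automorphisms :: "'a::euclidean_space set \<Rightarrow> ('a \<Rightarrow> 'a) set" where
  "cone_automorphisms C = {g. linear g \<and> bij g \<and> g ` interior C = interior C}"

definition symmetric_cone :: "'a::euclidean_space set \<Rightarrow> bool" where
  "symmetric_cone C \<longleftrightarrow>
     cone C \<and> closed C \<and> convex C \<and> C \<inter> uminus ` C = {0} \<and> interior C \<noteq> {} \<and>
     C = dual_cone C \<and>
     (\<forall>x\<in>interior C. \<forall>y\<in>interior C. \<exists>g\<in>cone_automorphisms C. g x = y)"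

definition cone_le :: "'a::real_vector set \<Rightarrow> 'a \<Rightarrow> 'a \<Rightarrow> bool" where
  "cone_le C x y \<longleftrightarrow> y - x \<in> C"

text \<open>\<open>funk_M C y x\<close> is the quantity $M(y/x)$.\<close>

definition funk_M :: "'a::real_vector set \<Rightarrow> 'a \<Rightarrow> 'a \<Rightarrow> real" where
  "funk_M C y x = Inf {l. 0 < l \<and> cone_le C y (l *\<^sub>R x)}"

definition RFunk :: "'a::real_vector set \<Rightarrow> 'a \<Rightarrow> 'a \<Rightarrow> real" where
  "RFunk C x y = ln (funk_M C y x)"

definition rho_bar :: "'a::euclidean_space set \<Rightarrow> ('a \<Rightarrow> 'a) \<Rightarrow> real" where
  "rho_bar C T = (INF y\<in>interior C. RFunk C y (T y))"

definition extreme_ray_of :: "'a::real_vector set \<Rightarrow> 'a set \<Rightarrow> bool" where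
  "extreme_ray_of R C \<longleftrightarrow> (\<exists>v. v \<noteq> 0 \<and> R = (\<lambda>t. t *\<^sub>R v) ` {0..}) \<and> R face_of C"

text \<open>The real-valued infima above are genuine: on the interior, the sets whose infimum is taken
  in \<open>funk_M\<close> and \<open>rho_bar\<close> are non-empty and bounded below, and \<open>funk_M\<close> is positive.\<close>

lemma interior_dominates:
  fixes x y :: "'a::euclidean_space"
  assumes "cone C" "x \<in> interior C"
  shows "\<exists>l>0. cone_le C y (l *\<^sub>R x)"
proof -
  obtain e where e: "e > 0" "ball x e \<subseteq> C"
    using assms(2) by (meson mem_interior)
  define d where "d = e / (2 * (norm y + 1))"
  have n: "norm y + 1 > 0"
    by (smt (verit) norm_ge_zero)
  have d: "d > 0"
    unfolding d_def using e n by simp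
  have "d * norm y \<le> d * (norm y + 1)"
    using d by (intro mult_left_mono) auto
  also have "\<dots> = e / 2"
    unfolding d_def using n by (simp add: field_simps)
  finally have "d * norm y < e"
    using e by simp
  then have "x - d *\<^sub>R y \<in> C"
    using e d by (auto simp: subset_iff dist_norm)
  then have "(1/d) *\<^sub>R (x - d *\<^sub>R y) \<in> C"
    using assms(1) d unfolding cone_def by simp
  then have "(1/d) *\<^sub>R x - y \<in> C"
    using d by (simp add: scaleR_diff_right)
  then show ?thesis
    using d unfolding cone_le_def by (intro exI[of _ "1/d"]) simp
qed

lemma cone_le_trans:
  assumes "cone C" "convex C" "cone_le C x y" "cone_le C y z"
  shows "cone_le C x z"
proof -
  have "(z - y) + (y - x) \<in> C"
    using assms convex_cone unfolding cone_le_def by blast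
  then show ?thesis unfolding cone_le_def by simp
qed

lemma cone_le_scale:
  assumes "cone C" "cone_le C x y" "0 \<le> a"
  shows "cone_le C (a *\<^sub>R x) (a *\<^sub>R y)"
  using assms unfolding cone_le_def cone_def by (metis scaleR_diff_right)

lemma RFunk_displacement_lower_bound:
  fixes C :: "'a::euclidean_space set"
  assumes C: "symmetric_cone C"
    and T: "T \<in> interior C \<rightarrow> interior C"
    and mono: "monotone_on (interior C) (cone_le C) (cone_le C) T"
    and hom: "\<And>l y. 0 < l \<Longrightarrow> y \<in> interior C \<Longrightarrow> T (l *\<^sub>R y) = l *\<^sub>R T y"
  obtains m where "0 < m"
    and "\<And>y l. y \<in> interior C \<Longrightarrow> 0 < l \<Longrightarrow> cone_le C (T y) (l *\<^sub>R y) \<Longrightarrow> m \<le> l"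
proof -
  have cn: "cone C" and cv: "convex C" and pt: "C \<inter> uminus ` C = {0}"
    and ne: "interior C \<noteq> {}"
    using C unfolding symmetric_cone_def by auto
  have sc: "l *\<^sub>R y \<in> interior C" if "y \<in> interior C" "0 < l" for l y
  proof -
    have "(*\<^sub>R) l ` C \<subseteq> C" using cn that unfolding cone_def by auto
    moreover have "interior ((*\<^sub>R) l ` C) = (*\<^sub>R) l ` interior C"
      using that by (intro interior_injective_linear_image) (auto simp: linear_scaleR inj_on_def)
    ultimately show ?thesis using interior_mono that by blast
  qed
  obtain e where e: "e \<in> interior C" using ne by auto
  have le0: "0 \<le> a" if "a *\<^sub>R e \<in> C" for a :: real
  proof (rule ccontr)
    assume a: "\<not> 0 \<le> a"
    then have "(1/(-a)) *\<^sub>R (a *\<^sub>R e) \<in> C"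
      using that cn unfolding cone_def by (metis less_eq_real_def linorder_not_less neg_0_less_iff_less zero_less_divide_1_iff)
    then have "- e \<in> C" using a by simp
    then have "e \<in> C \<inter> uminus ` C" using e interior_subset by force
    then have "e = 0" using pt by auto
    have "y = 0" for y :: 'a
    proof -
      obtain l where "l > 0" "cone_le C y (l *\<^sub>R e)" using interior_dominates[OF cn e] by blast
      moreover obtain l where "l > 0" "cone_le C (-y) (l *\<^sub>R e)" using interior_dominates[OF cn e] by blast
      ultimately have "y \<in> C \<inter> uminus ` C"
        using \<open>e = 0\<close> unfolding cone_le_def by force
      then show ?thesis using pt by auto
    qed
    then show False using nonempty_Basis nonzero_Basis by blast
  qed
  have Tk: "(T ^^ k) y \<in> interior C" if "y \<in> interior C" for k y
    using that T by (induction k) auto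
  obtain l0 where l0: "l0 > 0" "cone_le C e (l0 *\<^sub>R T e)"
    using interior_dominates[OF cn] e T by blast
  define m where "m = 1 / l0"
  have m: "m > 0" using l0 m_def by simp
  have mT: "cone_le C (m *\<^sub>R e) (T e)"
    using cone_le_scale[OF cn l0(2), of m] l0 m unfolding m_def by simp
  have low: "cone_le C (m ^ k *\<^sub>R e) ((T ^^ k) e)" for k
  proof (induction k)
    case 0
    then show ?case using cn e interior_subset unfolding cone_le_def
      by (metis cancel_comm_monoid_add_class.diff_cancel cone_0 empty_iff funpow_0 pt Int_iff insertI1 power_0 scaleR_one)
  next
    case (Suc k)
    have "cone_le C (T (m ^ k *\<^sub>R e)) (T ((T ^^ k) e))"
      using mono sc Tk e m Suc unfolding monotone_on_def by simp
    then have 1: "cone_le C (m ^ k *\<^sub>R T e) ((T ^^ Suc k) e)"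
      using hom e m by simp
    have "cone_le C (m ^ k *\<^sub>R (m *\<^sub>R e)) (m ^ k *\<^sub>R T e)"
      using cone_le_scale[OF cn mT] m by simp
    from cone_le_trans[OF cn cv this 1] show ?case by (simp add: mult.commute)
  qed
  have "m \<le> l" if y: "y \<in> interior C" and l: "0 < l" and le: "cone_le C (T y) (l *\<^sub>R y)" for y l
  proof (rule ccontr)
    assume "\<not> m \<le> l"
    then have gt: "m / l > 1" using l by simp
    obtain a where a: "a > 0" "cone_le C e (a *\<^sub>R y)" using interior_dominates[OF cn y] by blast
    obtain d where d: "d > 0" "cone_le C y (d *\<^sub>R e)" using interior_dominates[OF cn e] by blast
    have up: "cone_le C ((T ^^ k) y) (l ^ k *\<^sub>R y)" for k
    proof (induction k)
      case 0
      show ?case using pt unfolding cone_le_def by auto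
    next
      case (Suc k)
      have "cone_le C (T ((T ^^ k) y)) (T (l ^ k *\<^sub>R y))"
        using mono sc Tk y l Suc unfolding monotone_on_def by simp
      then have 1: "cone_le C ((T ^^ Suc k) y) (l ^ k *\<^sub>R T y)"
        using hom y l by simp
      have "cone_le C (l ^ k *\<^sub>R T y) (l ^ k *\<^sub>R (l *\<^sub>R y))"
        using cone_le_scale[OF cn le] l by simp
      from cone_le_trans[OF cn cv 1 this] show ?case by (simp add: mult.commute)
    qed
    have hk: "(T ^^ k) (b *\<^sub>R y) = b *\<^sub>R (T ^^ k) y" if "0 < b" for k b
      by (induction k) (use that hom Tk y in auto)
    have mk: "cone_le C ((T ^^ k) e) ((T ^^ k) (a *\<^sub>R y))" for k
      using a(2) by (induction k) (use mono Tk e y sc a(1) in \<open>auto simp: monotone_on_def\<close>)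
    have bd: "(m / l) ^ k \<le> a * d" for k
    proof -
      have "cone_le C (m ^ k *\<^sub>R e) (a *\<^sub>R (T ^^ k) y)"
        using cone_le_trans[OF cn cv low mk] hk a by simp
      also have "cone_le C (a *\<^sub>R (T ^^ k) y) (a *\<^sub>R (l ^ k *\<^sub>R y))"
        using cone_le_scale[OF cn up] a by simp
      note 1 = cone_le_trans[OF cn cv calculation this]
      have "cone_le C ((a * l ^ k) *\<^sub>R y) ((a * l ^ k) *\<^sub>R (d *\<^sub>R e))"
        using cone_le_scale[OF cn d(2)] a l by simp
      then have "cone_le C (m ^ k *\<^sub>R e) ((a * l ^ k * d) *\<^sub>R e)"
        using cone_le_trans[OF cn cv 1] by simp
      then have "(a * l ^ k * d - m ^ k) *\<^sub>R e \<in> C"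
        unfolding cone_le_def by (simp add: scaleR_diff_left)
      from le0[OF this] show ?thesis using l by (simp add: power_divide field_simps)
    qed
    obtain k where "a * d < (m / l) ^ k" using real_arch_pow[OF gt] by blast
    with bd[of k] show False by simp
  qed
  with m that show thesis by blast
qed

lemma RFunk_displacement_bdd_below:
  fixes C :: "'a::euclidean_space set"
  assumes C: "symmetric_cone C"
    and T: "T \<in> interior C \<rightarrow> interior C"
    and mono: "monotone_on (interior C) (cone_le C) (cone_le C) T"
    and hom: "\<And>l y. 0 < l \<Longrightarrow> y \<in> interior C \<Longrightarrow> T (l *\<^sub>R y) = l *\<^sub>R T y"
  shows "bdd_below ((\<lambda>y. RFunk C y (T y)) ` interior C)"
proof -
  obtain m where m: "0 < m"
    "\<And>y l. y \<in> interior C \<Longrightarrow> 0 < l \<Longrightarrow> cone_le C (T y) (l *\<^sub>R y) \<Longrightarrow> m \<le> l"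
    using RFunk_displacement_lower_bound[OF assms] by blast
  have cn: "cone C" using C unfolding symmetric_cone_def by blast
  have "ln m \<le> RFunk C y (T y)" if y: "y \<in> interior C" for y
  proof -
    have "m \<le> funk_M C (T y) y"
      unfolding funk_M_def using interior_dominates[OF cn y, of "T y"] m y
      by (intro cInf_greatest) auto
    then show ?thesis unfolding RFunk_def using m by simp
  qed
  then show ?thesis unfolding bdd_below_def by auto
qed

lemma funk_M_pos:
  fixes C :: "'a::euclidean_space set"
  assumes C: "symmetric_cone C" and x: "x \<in> interior C" and y: "y \<in> interior C"
  shows "{l. 0 < l \<and> cone_le C y (l *\<^sub>R x)} \<noteq> {}" and "0 < funk_M C y x"
proof -
  have cn: "cone C" and cv: "convex C" using C unfolding symmetric_cone_def by blast+
  show ne: "{l. 0 < l \<and> cone_le C y (l *\<^sub>R x)} \<noteq> {}"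
    using interior_dominates[OF cn x] by auto
  obtain m where m: "0 < m"
    "\<And>z l. z \<in> interior C \<Longrightarrow> 0 < l \<Longrightarrow> cone_le C (id z) (l *\<^sub>R z) \<Longrightarrow> m \<le> l"
    by (rule RFunk_displacement_lower_bound[of C id]) (use C in \<open>auto simp: monotone_on_def\<close>)
  obtain a where a: "a > 0" "cone_le C x (a *\<^sub>R y)" using interior_dominates[OF cn y] by blast
  have "m / a \<le> l" if l: "0 < l" "cone_le C y (l *\<^sub>R x)" for l
  proof -
    have "cone_le C x ((a * l) *\<^sub>R x)"
      using cone_le_trans[OF cn cv a(2) cone_le_scale[OF cn l(2), of a]] a by simp
    then have "m \<le> a * l" using m(2)[OF x, of "a * l"] a l by simp
    then show ?thesis using a by (simp add: field_simps)
  qed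
  then have "m / a \<le> funk_M C y x"
    unfolding funk_M_def using ne by (intro cInf_greatest) auto
  then show "0 < funk_M C y x" using m a by (smt (verit) divide_pos_pos)
qed

end

theory Submission
  imports Defs
begin

text \<open>
Write \<open>\<rho>\<close> for \<open>exp (rho_bar C T)\<close>. By definition \<open>\<rho>\<close> is the infimum of the \<open>l > 0\<close>
for which some interior point \<open>y\<close> satisfies \<open>T y \<le> l y\<close>. Such a supersolution bounds every
orbit from above, \<open>T\<^sup>k x \<le> c l\<^sup>k x\<close> (\<open>iterate_supersolution\<close>), so the escape rate is at
most \<open>rho_bar\<close>. The content of the theorem is the converse bound, with an extreme ray as
witness.

It comes from a subsolution, found as a limit of nonlinear eigenvectors. Perturbing \<open>T\<close> to
\<open>y \<mapsto> T (y + \<epsilon> u)\<close>, with \<open>u\<close> interior, gives a map that is defined on the whole cone. After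
normalization it has a Brouwer fixed point on a compact base of the cone, that is, an interior
\<open>y\<close> with \<open>T (y + \<epsilon> u) = l y\<close> (\<open>perturbed_eigenvector\<close>). By monotonicity \<open>T y \<le> l y\<close>, hence
\<open>l \<ge> \<rho>\<close>: whatever the size of \<open>\<epsilon>\<close>, the eigenvalue does not fall below \<open>\<rho>\<close>. A limit \<open>y\<close> of
these vectors as \<open>\<epsilon> \<rightarrow> 0\<close> is a nonzero vector of the cone, possibly on its boundary, with
\<open>T z \<ge> \<rho> y\<close> for all interior \<open>z \<ge> y\<close> (\<open>subeigenvector_exists\<close>).

Given an interior \<open>x\<close>, rescale \<open>y\<close> to be the largest multiple below \<open>x\<close>. Then
\<open>T\<^sup>k x \<ge> \<rho>\<^sup>k y\<close> for all \<open>k\<close>. Maximality means that \<open>x - y\<close> is a boundary point, so some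
nonzero \<open>v\<close> in the dual cone is orthogonal to it; since \<open>v\<close> maximizes the ratio of
\<open>\<langle>w, y\<rangle>\<close> to \<open>\<langle>w, x\<rangle>\<close>, it can be chosen on an extreme ray
(\<open>extreme_ray_maximizing_ratio\<close>). Pairing with \<open>v\<close> yields
\<open>\<langle>v, T\<^sup>k x\<rangle> \<ge> \<rho>\<^sup>k \<langle>v, y\<rangle> = \<rho>\<^sup>k \<langle>v, x\<rangle>\<close> for all \<open>k\<close> with one and the same \<open>v\<close>. In
particular \<open>T\<^sup>k x \<le> l x\<close> forces \<open>l \<ge> \<rho>\<^sup>k\<close>, which is the lower bound on the escape rate.
Self-duality serves to place \<open>v\<close> in the cone itself.
\<close>

section \<open>Cones, their interiors and compact bases\<close>

lemma convex_cone_add: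
  assumes "cone C" "convex C" "x \<in> C" "y \<in> C"
  shows "x + y \<in> C"
  using assms convex_cone by blast

lemma cone_scaleR:
  assumes "cone C" "x \<in> C" "0 \<le> a"
  shows "a *\<^sub>R x \<in> C"
  using assms unfolding cone_def by simp

lemma interior_cone_add:
  fixes C :: "'a::euclidean_space set"
  assumes "cone C" "convex C" "x \<in> interior C" "y \<in> C"
  shows "x + y \<in> interior C"
proof -
  obtain r where r: "r > 0" "ball x r \<subseteq> C"
    using assms(3) by (meson mem_interior)
  have "ball (x + y) r \<subseteq> C"
  proof
    fix z assume "z \<in> ball (x + y) r"
    then have "z - y \<in> C"
      using r by (auto simp: subset_iff dist_norm algebra_simps)
    from convex_cone_add[OF assms(1,2) this assms(4)] show "z \<in> C" by simp
  qed
  then show ?thesis using r mem_interior by blast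
qed

lemma interior_cone_scaleR:
  fixes C :: "'a::euclidean_space set"
  assumes "cone C" "x \<in> interior C" "0 < a"
  shows "a *\<^sub>R x \<in> interior C"
proof -
  have "(*\<^sub>R) a ` C \<subseteq> C" using assms unfolding cone_def by auto
  moreover have "interior ((*\<^sub>R) a ` C) = (*\<^sub>R) a ` interior C"
    using assms by (intro interior_injective_linear_image) (auto simp: linear_scaleR inj_on_def)
  ultimately show ?thesis using interior_mono assms by blast
qed

text \<open>An interior point \<open>e\<close> of the dual cone stays in it when moved by a fixed distance in the
  direction \<open>- w\<close>; pairing the moved point with \<open>w\<close> gives the estimate. It makes the
  linear form of \<open>e\<close> comparable to the norm on the cone, hence gives compact bases.\<close>

lemma norm_le_inner_interior_dual:
  fixes C :: "'a::euclidean_space set"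
  assumes "e \<in> interior (dual_cone C)"
  obtains c where "0 < c" "\<And>w. w \<in> C \<Longrightarrow> c * norm w \<le> w \<bullet> e"
proof -
  obtain r where r: "r > 0" "cball e r \<subseteq> dual_cone C"
    using assms by (meson mem_interior_cball)
  have "r * norm w \<le> w \<bullet> e" if "w \<in> C" for w
  proof (cases "w = 0")
    case False
    have "e - (r / norm w) *\<^sub>R w \<in> dual_cone C"
      using r False by (auto simp: subset_iff dist_norm)
    then have "0 \<le> (e - (r / norm w) *\<^sub>R w) \<bullet> w"
      using that unfolding dual_cone_def by blast
    also have "\<dots> = w \<bullet> e - r * norm w"
      using False by (simp add: inner_diff_left inner_commute[of e] dot_square_norm power2_eq_square)
    finally show ?thesis by simp
  qed simp
  with r that show thesis by blast
qed

lemma inner_interior_dual_pos: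
  fixes C :: "'a::euclidean_space set"
  assumes "e \<in> interior (dual_cone C)" "w \<in> C" "w \<noteq> 0"
  shows "0 < w \<bullet> e"
proof -
  obtain c where c: "0 < c" "c * norm w \<le> w \<bullet> e"
    using norm_le_inner_interior_dual[OF assms(1)] assms(2) by metis
  have "0 < c * norm w" using c assms(3) by simp
  with c show ?thesis by linarith
qed

lemma zero_notin_interior_cone:
  fixes C :: "'a::euclidean_space set"
  assumes "e \<in> interior (dual_cone C)"
  shows "0 \<notin> interior C"
proof
  assume "0 \<in> interior C"
  then obtain r where r: "0 < r" "cball 0 r \<subseteq> C" by (metis mem_interior_cball)
  obtain b :: 'a where b: "b \<in> Basis" using nonempty_Basis by blast
  then have "r *\<^sub>R b \<in> C" "- (r *\<^sub>R b) \<in> C" "r *\<^sub>R b \<noteq> 0"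
    using r by (auto simp: subset_iff)
  then have "0 < (r *\<^sub>R b) \<bullet> e" "0 < (- (r *\<^sub>R b)) \<bullet> e"
    using inner_interior_dual_pos[OF assms] by (metis, metis neg_equal_0_iff_equal)
  then show False by simp
qed

definition cone_base :: "'a::real_inner set \<Rightarrow> 'a \<Rightarrow> 'a set" where
  "cone_base C e = {w \<in> C. w \<bullet> e = 1}"

lemma convex_cone_base: "convex C \<Longrightarrow> convex (cone_base C e)"
  unfolding cone_base_def convex_def by (auto simp: inner_add_left)

lemma compact_cone_base:
  fixes C :: "'a::euclidean_space set"
  assumes "closed C" "e \<in> interior (dual_cone C)"
  shows "compact (cone_base C e)"
proof -
  obtain c where c: "0 < c" "\<And>w. w \<in> C \<Longrightarrow> c * norm w \<le> w \<bullet> e"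
    using norm_le_inner_interior_dual[OF assms(2)] by blast
  have "norm w \<le> 1 / c" if "w \<in> cone_base C e" for w
    using c(1) c(2)[of w] that by (auto simp: field_simps cone_base_def)
  then have "bounded (cone_base C e)"
    unfolding bounded_iff by blast
  moreover have "cone_base C e = C \<inter> {w. e \<bullet> w = 1}"
    by (auto simp: cone_base_def inner_commute)
  then have "closed (cone_base C e)"
    using assms(1) closed_hyperplane[of e 1] by (simp add: closed_Int)
  ultimately show ?thesis
    using compact_eq_bounded_closed by blast
qed

lemma cone_base_normalize:
  fixes C :: "'a::euclidean_space set"
  assumes "cone C" "e \<in> interior (dual_cone C)" "w \<in> C" "w \<noteq> 0"
  shows "(1 / (w \<bullet> e)) *\<^sub>R w \<in> cone_base C e"
  using inner_interior_dual_pos[OF assms(2-4)] assms(3)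
  by (auto simp: cone_base_def intro!: cone_scaleR[OF assms(1)])

section \<open>Extreme rays maximizing a ratio of linear forms\<close>

text \<open>The ratio of \<open>w \<bullet> y\<close> to \<open>w \<bullet> x\<close> attains its maximum \<open>m\<close> on the compact base where
  \<open>w \<bullet> x = 1\<close>. The maximizers form a compact convex set, and an extreme point of it spans an
  extreme ray of the whole cone, because the form \<open>w \<mapsto> m (w \<bullet> x) - w \<bullet> y\<close> is nonnegative on
  the cone and therefore vanishes at both ends of any open segment that meets the ray.\<close>

lemma extreme_ray_maximizing_ratio:
  fixes C :: "'a::euclidean_space set"
  assumes C: "cone C" "convex C" "closed C" and nz: "C - {0} \<noteq> {}"
    and x: "x \<in> interior (dual_cone C)"
  obtains v where "v \<in> C" "v \<bullet> x = 1" "extreme_ray_of ((\<lambda>t. t *\<^sub>R v) ` {0..}) C"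
    "\<And>w. w \<in> C \<Longrightarrow> w \<bullet> y \<le> (v \<bullet> y) * (w \<bullet> x)"
proof -
  let ?B = "cone_base C x"
  have ne: "?B \<noteq> {}"
    using nz cone_base_normalize[OF C(1) x] by blast
  obtain u where u: "u \<in> ?B" "\<And>w. w \<in> ?B \<Longrightarrow> w \<bullet> y \<le> u \<bullet> y"
    using continuous_attains_sup[OF compact_cone_base[OF C(3) x] ne
        continuous_on_inner[OF continuous_on_id continuous_on_const]] by metis
  define m where "m = u \<bullet> y"
  have m: "w \<bullet> y \<le> m * (w \<bullet> x)" if "w \<in> C" for w
  proof (cases "w = 0")
    case False
    have "(1 / (w \<bullet> x)) * (w \<bullet> y) \<le> m"
      using u(2)[OF cone_base_normalize[OF C(1) x that False]] by (simp add: m_def)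
    then show ?thesis
      using inner_interior_dual_pos[OF x that False] by (simp add: field_simps)
  qed simp
  define F where "F = ?B \<inter> {w. y \<bullet> w = m}"
  have "compact F"
    unfolding F_def using compact_cone_base[OF C(3) x] closed_hyperplane by (rule compact_Int_closed)
  moreover have "convex F"
    unfolding F_def using convex_cone_base[OF C(2)] convex_hyperplane by (rule convex_Int)
  moreover have "F \<noteq> {}"
    using u(1) by (auto simp: F_def m_def inner_commute)
  ultimately obtain v where v: "v extreme_point_of F"
    using extreme_point_exists_convex by blast
  have vF: "v \<in> F" using v by (simp add: extreme_point_of_def)
  have vC: "v \<in> C" and vx: "v \<bullet> x = 1" and vy: "v \<bullet> y = m"
    using vF by (auto simp: F_def cone_base_def inner_commute)
  let ?R = "(\<lambda>t. t *\<^sub>R v) ` {0..}"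
  have "?R face_of C"
    unfolding face_of_def
  proof (intro conjI ballI impI)
    show "?R \<subseteq> C" using cone_scaleR[OF C(1) vC] by auto
    have "linear (\<lambda>t::real. t *\<^sub>R v)" by (simp add: linear_iff scaleR_left_distrib)
    then show "convex ?R" by (simp add: convex_linear_image)
    fix a b p assume ab: "a \<in> C" "b \<in> C" and p: "p \<in> ?R" "p \<in> open_segment a b"
    obtain t where t: "0 \<le> t" "p = t *\<^sub>R v" using p by auto
    obtain s where s: "0 < s" "s < 1" "t *\<^sub>R v = (1 - s) *\<^sub>R a + s *\<^sub>R b"
      using p t by (auto simp: in_segment)
    \<comment> \<open>Both ends of the segment are maximizers of the ratio, since the gap is nonnegative.\<close>
    define gap where "gap w = m * (w \<bullet> x) - w \<bullet> y" for w
    have "gap (t *\<^sub>R v) = 0" by (simp add: gap_def vx vy)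
    moreover have "gap (t *\<^sub>R v) = (1 - s) * gap a + s * gap b"
      unfolding s(3) gap_def by (simp add: inner_add_left algebra_simps)
    moreover have "0 \<le> gap a" "0 \<le> gap b" using m ab by (auto simp: gap_def)
    ultimately have gap: "gap a = 0" "gap b = 0"
      using s by (smt (verit) mult_nonneg_nonneg mult_pos_pos)+
    have inF: "(1 / (w \<bullet> x)) *\<^sub>R w \<in> F" if "w \<in> C" "w \<noteq> 0" "gap w = 0" for w
      using cone_base_normalize[OF C(1) x that(1,2)] that(3) inner_interior_dual_pos[OF x that(1,2)]
      by (auto simp: F_def gap_def inner_commute[of y] field_simps)
    have onray: "w \<in> ?R" if "w = r *\<^sub>R v" "0 \<le> r" for w r
      using that by auto
    have "a \<in> ?R \<and> b \<in> ?R"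
    proof (cases "a = 0 \<or> b = 0")
      case True
      then consider "a = 0" | "b = 0" by blast
      then show ?thesis
      proof cases
        case 1
        then have "b = (t / s) *\<^sub>R v"
          using s by (metis add_0 divide_inverse_commute left_inverse less_numeral_extra(3)
              scaleR_one scaleR_scaleR scaleR_zero_right)
        then show ?thesis using onray[of b "t / s"] onray[of a 0] 1 s t by simp
      next
        case 2
        then have "t *\<^sub>R v = (1 - s) *\<^sub>R a" using s by simp
        then have "a = (t / (1 - s)) *\<^sub>R v"
          using s by (metis divide_inverse_commute left_inverse less_numeral_extra(3)
              diff_gt_0_iff_gt scaleR_one scaleR_scaleR)
        then show ?thesis using onray[of a "t / (1 - s)"] onray[of b 0] 2 s t by simp
      qed
    next
      case False
      \<comment> \<open>Rescaling both ends to the base turns the segment through \<open>t v\<close> into one inside \<open>F\<close>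
        through the extreme point \<open>v\<close>, so that it must be degenerate.\<close>
      define \<alpha> \<beta> where "\<alpha> = a \<bullet> x" and "\<beta> = b \<bullet> x"
      have pos: "\<alpha> > 0" "\<beta> > 0"
        using inner_interior_dual_pos[OF x] ab False by (auto simp: \<alpha>_def \<beta>_def)
      define a' b' where "a' = (1 / \<alpha>) *\<^sub>R a" and "b' = (1 / \<beta>) *\<^sub>R b"
      have a'b': "a' \<in> F" "b' \<in> F"
        using inF ab gap False by (auto simp: a'_def b'_def \<alpha>_def \<beta>_def)
      have ab_eq: "a = \<alpha> *\<^sub>R a'" "b = \<beta> *\<^sub>R b'"
        using pos by (auto simp: a'_def b'_def)
      have "(t *\<^sub>R v) \<bullet> x = ((1 - s) *\<^sub>R a + s *\<^sub>R b) \<bullet> x" by (simp only: s(3))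
      then have teq: "t = (1 - s) * \<alpha> + s * \<beta>"
        by (simp add: vx \<alpha>_def \<beta>_def inner_add_left)
      have p1: "0 < (1 - s) * \<alpha>" "0 < s * \<beta>" using s pos by auto
      then have tpos: "t > 0" using teq by linarith
      define q where "q = s * \<beta> / t"
      have q: "0 < q" "q < 1" "1 - q = (1 - s) * \<alpha> / t"
        using p1 tpos teq by (auto simp: q_def field_simps)
      have "v = (1 / t) *\<^sub>R (t *\<^sub>R v)" using tpos by simp
      also have "\<dots> = (1 - q) *\<^sub>R a' + q *\<^sub>R b'"
        unfolding s(3) q(3) by (simp add: ab_eq scaleR_add_right q_def)
      finally have veq: "v = (1 - q) *\<^sub>R a' + q *\<^sub>R b'" .
      have "a' = b'"
      proof (rule ccontr)
        assume "a' \<noteq> b'"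
        then have "v \<in> open_segment a' b'"
          using veq q by (auto simp: in_segment)
        then show False using v a'b' by (auto simp: extreme_point_of_def)
      qed
      then have "a' = v" "b' = v" using veq by (auto simp: scaleR_left_diff_distrib)
      then show ?thesis
        using onray[OF ab_eq(1)[unfolded \<open>a' = v\<close>]] onray[OF ab_eq(2)[unfolded \<open>b' = v\<close>]] pos
        by simp
    qed
    then show "a \<in> ?R" "b \<in> ?R" by blast+
  qed
  moreover have "v \<noteq> 0" using vx by auto
  ultimately have "extreme_ray_of ?R C" unfolding extreme_ray_of_def by blast
  with vC vx vy m that show thesis by blast
qed

section \<open>Order-preserving homogeneous maps\<close>

text \<open>The results of this section concern an arbitrary closed convex cone; where a compact base
  matters, an interior point of the dual cone is assumed to exist.\<close>

locale monotone_homogeneous_map =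
  fixes C :: "'a::euclidean_space set" and T :: "'a \<Rightarrow> 'a"
  assumes cone: "cone C" and convex: "convex C" and closed: "closed C"
    and maps: "T \<in> interior C \<rightarrow> interior C"
    and mono: "monotone_on (interior C) (cone_le C) (cone_le C) T"
    and hom: "\<And>l y. 0 < l \<Longrightarrow> y \<in> interior C \<Longrightarrow> T (l *\<^sub>R y) = l *\<^sub>R T y"
begin

lemma map_interior: "y \<in> interior C \<Longrightarrow> T y \<in> interior C"
  using maps by auto

lemma iterate_interior: "y \<in> interior C \<Longrightarrow> (T ^^ k) y \<in> interior C"
  by (induction k) (auto intro: map_interior)

lemma map_mono: "y \<in> interior C \<Longrightarrow> z \<in> interior C \<Longrightarrow> z - y \<in> C \<Longrightarrow> T z - T y \<in> C"
  using mono unfolding monotone_on_def cone_le_def by blast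

lemma iterate_mono:
  assumes "y \<in> interior C" "z \<in> interior C" "z - y \<in> C"
  shows "(T ^^ k) z - (T ^^ k) y \<in> C"
  by (induction k) (use assms map_mono iterate_interior in auto)

lemma iterate_hom:
  assumes "0 < l" "y \<in> interior C"
  shows "(T ^^ k) (l *\<^sub>R y) = l *\<^sub>R (T ^^ k) y"
  by (induction k) (use assms hom iterate_interior in auto)

text \<open>A point near \<open>x\<close> lies between \<open>(1 - d) x\<close> and \<open>(1 + d) x\<close> in the cone order, with \<open>d\<close>
  proportional to its distance from \<open>x\<close>. The map preserves these bounds, and an order
  interval of length \<open>2 d (T x)\<close> has norm diameter of order \<open>d\<close>.\<close>

lemma isCont_interior:
  assumes e: "e \<in> interior (dual_cone C)" and x: "x \<in> interior C"
  shows "isCont T x"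
proof -
  obtain c where c: "0 < c" "\<And>w. w \<in> C \<Longrightarrow> c * norm w \<le> w \<bullet> e"
    using norm_le_inner_interior_dual[OF e] by blast
  obtain r where r: "r > 0" "cball x r \<subseteq> interior C"
    using x open_contains_cball open_interior by blast
  define L where "L = 2 * (T x \<bullet> e) / c + norm (T x)"
  have bound: "norm (T y - T x) \<le> (L / r) * norm (y - x)"
    if y: "norm (y - x) < r" for y
  proof (cases "y = x")
    case False
    define d where "d = norm (y - x) / r"
    have d: "0 < d" "d < 1" "norm (y - x) = d * r"
      using y r False by (auto simp: d_def)
    have yi: "y \<in> interior C"
      using r y by (auto simp: subset_iff dist_norm norm_minus_commute)
    have near: "x + (1 / d) *\<^sub>R (y - x) \<in> C" "x - (1 / d) *\<^sub>R (y - x) \<in> C"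
      using r d interior_subset[of C] by (auto simp: subset_iff dist_norm)
    have "d *\<^sub>R (x + (1 / d) *\<^sub>R (y - x)) \<in> C" "d *\<^sub>R (x - (1 / d) *\<^sub>R (y - x)) \<in> C"
      using near d cone_scaleR[OF cone] by auto
    then have "y - (1 - d) *\<^sub>R x \<in> C" "(1 + d) *\<^sub>R x - y \<in> C"
      using d by (auto simp: algebra_simps)
    then have "T y - T ((1 - d) *\<^sub>R x) \<in> C" "T ((1 + d) *\<^sub>R x) - T y \<in> C"
      using map_mono yi interior_cone_scaleR[OF cone x] d by auto
    then have lo: "T y - (1 - d) *\<^sub>R T x \<in> C" and hi: "(1 + d) *\<^sub>R T x - T y \<in> C"
      using hom x d by auto
    have "0 \<le> ((1 + d) *\<^sub>R T x - T y) \<bullet> e"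
      using c(2)[OF hi] c(1) by (meson mult_nonneg_nonneg norm_ge_zero order_trans less_imp_le)
    then have "(T y - (1 - d) *\<^sub>R T x) \<bullet> e \<le> 2 * d * (T x \<bullet> e)"
      by (simp add: inner_diff_left algebra_simps)
    with c(2)[OF lo] have "c * norm (T y - (1 - d) *\<^sub>R T x) \<le> 2 * d * (T x \<bullet> e)" by linarith
    then have 1: "norm (T y - (1 - d) *\<^sub>R T x) \<le> 2 * d * (T x \<bullet> e) / c"
      using c(1) by (simp add: field_simps)
    have "T y - T x = (T y - (1 - d) *\<^sub>R T x) - d *\<^sub>R T x"
      by (simp add: algebra_simps)
    then have "norm (T y - T x) \<le> norm (T y - (1 - d) *\<^sub>R T x) + d * norm (T x)"
      by (metis norm_triangle_ineq4 norm_scaleR abs_of_pos d(1))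
    also have "\<dots> \<le> d * L"
      using 1 by (simp add: L_def algebra_simps)
    finally show ?thesis by (simp add: d_def mult.commute)
  qed simp
  have "((\<lambda>y. T y - T x) \<longlongrightarrow> 0) (at x)"
  proof (rule Lim_null_comparison)
    show "\<forall>\<^sub>F y in at x. norm (T y - T x) \<le> (L / r) * norm (y - x)"
      unfolding eventually_at using bound r by (auto simp: dist_norm)
    have "((\<lambda>y. (L / r) * norm (y - x)) \<longlongrightarrow> (L / r) * norm (x - x)) (at x)"
      by (intro tendsto_intros)
    then show "((\<lambda>y. (L / r) * norm (y - x)) \<longlongrightarrow> 0) (at x)" by simp
  qed
  then show ?thesis
    using LIM_zero_cancel isCont_def by blast
qed

text \<open>The shift by \<open>\<epsilon> u\<close> moves boundary points to the interior, where \<open>T\<close> is defined and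
  continuous. Brouwer's theorem therefore applies on the whole compact base.\<close>

lemma perturbed_eigenvector:
  assumes e: "e \<in> interior (dual_cone C)" and u: "u \<in> interior C" and eps: "0 < \<epsilon>"
  obtains y l where "y \<in> interior C" "y \<bullet> e = 1" "0 < l" "T (y + \<epsilon> *\<^sub>R u) = l *\<^sub>R y"
proof -
  let ?B = "cone_base C e"
  have shift: "y + \<epsilon> *\<^sub>R u \<in> interior C" if "y \<in> C" for y
    using interior_cone_add[OF cone convex interior_cone_scaleR[OF cone u eps] that]
    by (simp add: add.commute)
  have Timage: "T (y + \<epsilon> *\<^sub>R u) \<in> C" "0 < T (y + \<epsilon> *\<^sub>R u) \<bullet> e" if "y \<in> C" for y
  proof -
    have i: "T (y + \<epsilon> *\<^sub>R u) \<in> interior C" using map_interior shift that by blast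
    then show "T (y + \<epsilon> *\<^sub>R u) \<in> C" using interior_subset by blast
    have "T (y + \<epsilon> *\<^sub>R u) \<noteq> 0" using i zero_notin_interior_cone[OF e] by metis
    then show "0 < T (y + \<epsilon> *\<^sub>R u) \<bullet> e"
      using inner_interior_dual_pos[OF e] i interior_subset by blast
  qed
  have "u \<in> C" "u \<noteq> 0" using u zero_notin_interior_cone[OF e] interior_subset by auto
  then have "?B \<noteq> {}" using cone_base_normalize[OF cone e] by blast
  moreover define f where "f y = (1 / (T (y + \<epsilon> *\<^sub>R u) \<bullet> e)) *\<^sub>R T (y + \<epsilon> *\<^sub>R u)" for y
  have contT: "continuous_on ?B (\<lambda>y. T (y + \<epsilon> *\<^sub>R u))"
  proof (rule continuous_on_compose2[of "interior C" T])
    show "continuous_on (interior C) T"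
      using isCont_interior[OF e] by (simp add: continuous_at_imp_continuous_on)
  qed (use shift in \<open>auto intro!: continuous_intros simp: cone_base_def\<close>)
  have "continuous_on ?B f"
    unfolding f_def
    by (intro continuous_intros contT) (use Timage(2) in \<open>force simp: cone_base_def\<close>)
  moreover have "f \<in> ?B \<rightarrow> ?B"
  proof
    fix y assume "y \<in> ?B"
    then have "y \<in> C" by (simp add: cone_base_def)
    then show "f y \<in> ?B"
      unfolding f_def using Timage[of y] by (intro cone_base_normalize[OF cone e]) auto
  qed
  ultimately obtain y where y: "y \<in> ?B" "f y = y"
    using brouwer[OF compact_cone_base[OF closed e] convex_cone_base[OF convex]] by blast
  define l where "l = T (y + \<epsilon> *\<^sub>R u) \<bullet> e"
  have yC: "y \<in> C" and ye: "y \<bullet> e = 1" using y by (auto simp: cone_base_def)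
  have l: "0 < l" using Timage yC by (simp add: l_def)
  have Ty: "T (y + \<epsilon> *\<^sub>R u) = l *\<^sub>R f y"
    using l by (simp add: f_def l_def)
  have "f y \<in> interior C"
    unfolding f_def using l map_interior[OF shift[OF yC]]
    by (intro interior_cone_scaleR[OF cone]) (auto simp: l_def)
  then show thesis using that y(2) ye l Ty by metis
qed

text \<open>The limit \<open>y\<close> may lie on the boundary, outside the domain of \<open>T\<close>. The inequality
  \<open>T y \<ge> r y\<close> is therefore replaced by a condition on the interior points above \<open>y\<close>, which
  survives the passage to the limit without any continuity of \<open>T\<close> at the boundary. The hypothesis on
  supersolutions bounds all the perturbed eigenvalues from below by \<open>r\<close>.\<close>

lemma subeigenvector_exists:
  assumes e: "e \<in> interior (dual_cone C)" and u: "u \<in> interior C"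
    and super: "\<And>y l. y \<in> interior C \<Longrightarrow> 0 < l \<Longrightarrow> l *\<^sub>R y - T y \<in> C \<Longrightarrow> r \<le> l"
  obtains y where "y \<in> C" "y \<noteq> 0"
    "\<And>z. z \<in> interior C \<Longrightarrow> z - y \<in> C \<Longrightarrow> T z - r *\<^sub>R y \<in> C"
proof -
  have "\<exists>y. y \<in> interior C \<and> y \<bullet> e = 1 \<and> T (y + (1 / Suc n) *\<^sub>R u) - r *\<^sub>R y \<in> C" for n
  proof -
    let ?\<epsilon> = "1 / Suc n"
    obtain y l where y: "y \<in> interior C" "y \<bullet> e = 1" "0 < l" "T (y + ?\<epsilon> *\<^sub>R u) = l *\<^sub>R y"
      using perturbed_eigenvector[OF e u, of ?\<epsilon>] by auto
    have yC: "y \<in> C" and uC: "u \<in> C" using y u interior_subset by auto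
    have \<epsilon>u: "?\<epsilon> *\<^sub>R u \<in> C" by (rule cone_scaleR[OF cone uC]) simp
    have "l *\<^sub>R y - T y \<in> C"
      using map_mono[OF y(1) interior_cone_add[OF cone convex y(1) \<epsilon>u]] \<epsilon>u y(4) by simp
    then have "r \<le> l" using super y by blast
    then have "(l - r) *\<^sub>R y \<in> C" using cone_scaleR[OF cone yC] by simp
    then show ?thesis using y by (auto simp: scaleR_left_diff_distrib)
  qed
  then obtain Y where Y: "\<And>n. Y n \<in> interior C" "\<And>n. Y n \<bullet> e = 1"
    "\<And>n. T (Y n + (1 / Suc n) *\<^sub>R u) - r *\<^sub>R Y n \<in> C" by metis
  have "\<forall>n. Y n \<in> cone_base C e" using Y(1,2) interior_subset[of C] by (auto simp: cone_base_def)
  then obtain y s where y: "y \<in> cone_base C e" and s: "strict_mono s" "(Y \<circ> s) \<longlonglongrightarrow> y"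
    using compact_cone_base[OF closed e] unfolding compact_def by metis
  have eps: "(\<lambda>n. 1 / real (Suc (s n))) \<longlonglongrightarrow> 0"
    using LIMSEQ_subseq_LIMSEQ[OF lim_inverse_n' [THEN LIMSEQ_Suc] s(1)] by (simp add: o_def)
  have Ys: "(\<lambda>n. Y (s n)) \<longlonglongrightarrow> y" using s(2) by (simp add: o_def)
  have "T z - r *\<^sub>R y \<in> C" if z: "z \<in> interior C" "z - y \<in> C" for z
  proof -
    \<comment> \<open>Enlarging \<open>z\<close> slightly puts it strictly above \<open>y\<close>, hence above all but finitely many
      of the perturbed vectors.\<close>
    have *: "(1 + d) *\<^sub>R T z - r *\<^sub>R y \<in> C" if d: "0 < d" for d
    proof -
      have dz: "(1 + d) *\<^sub>R z \<in> interior C" using interior_cone_scaleR[OF cone z(1)] d by simp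
      have "d *\<^sub>R z + (z - y) \<in> interior C"
        using interior_cone_add[OF cone convex interior_cone_scaleR[OF cone z(1) d] z(2)] .
      moreover have "(\<lambda>n. (1 + d) *\<^sub>R z - (Y (s n) + (1 / Suc (s n)) *\<^sub>R u))
          \<longlonglongrightarrow> (1 + d) *\<^sub>R z - (y + 0 *\<^sub>R u)"
        by (intro tendsto_intros Ys eps)
      moreover have "(1 + d) *\<^sub>R z - (y + 0 *\<^sub>R u) = d *\<^sub>R z + (z - y)"
        by (simp add: algebra_simps)
      ultimately have "(\<lambda>n. (1 + d) *\<^sub>R z - (Y (s n) + (1 / Suc (s n)) *\<^sub>R u))
          \<longlonglongrightarrow> d *\<^sub>R z + (z - y)" "d *\<^sub>R z + (z - y) \<in> interior C" by argo+
      then have "\<forall>\<^sub>F n in sequentially.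
          (1 + d) *\<^sub>R z - (Y (s n) + (1 / Suc (s n)) *\<^sub>R u) \<in> interior C"
        by (rule topological_tendstoD[OF _ open_interior])
      then have ev: "\<forall>\<^sub>F n in sequentially. (1 + d) *\<^sub>R T z - r *\<^sub>R Y (s n) \<in> C"
      proof (rule eventually_mono)
        fix n assume "(1 + d) *\<^sub>R z - (Y (s n) + (1 / Suc (s n)) *\<^sub>R u) \<in> interior C"
        then have 1: "(1 + d) *\<^sub>R z - (Y (s n) + (1 / Suc (s n)) *\<^sub>R u) \<in> C"
          using interior_subset by blast
        have 2: "Y (s n) + (1 / Suc (s n)) *\<^sub>R u \<in> interior C"
          using u interior_subset
          by (intro interior_cone_add[OF cone convex Y(1)] cone_scaleR[OF cone]) auto
        have "(1 + d) *\<^sub>R T z - T (Y (s n) + (1 / Suc (s n)) *\<^sub>R u) \<in> C"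
          using map_mono[OF 2 dz 1] hom[of "1 + d" z] z d by simp
        from convex_cone_add[OF cone convex this Y(3)[of "s n"]]
        show "(1 + d) *\<^sub>R T z - r *\<^sub>R Y (s n) \<in> C" by simp
      qed
      have "(\<lambda>n. (1 + d) *\<^sub>R T z - r *\<^sub>R Y (s n)) \<longlonglongrightarrow> (1 + d) *\<^sub>R T z - r *\<^sub>R y"
        by (intro tendsto_intros Ys)
      from Lim_in_closed_set[OF closed ev _ this] show ?thesis by simp
    qed
    have "(\<lambda>n. (1 + 1 / Suc (s n)) *\<^sub>R T z - r *\<^sub>R y) \<longlonglongrightarrow> (1 + 0) *\<^sub>R T z - r *\<^sub>R y"
      by (intro tendsto_intros eps)
    then have "(1 + 0) *\<^sub>R T z - r *\<^sub>R y \<in> C"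
      by (rule Lim_in_closed_set[OF closed, rotated 2]) (auto intro!: always_eventually *)
    then show ?thesis by simp
  qed
  moreover have "y \<in> C" "y \<noteq> 0" using y by (auto simp: cone_base_def)
  ultimately show thesis using that by blast
qed

lemma iterate_subeigenvector:
  assumes sub: "\<And>z. z \<in> interior C \<Longrightarrow> z - y \<in> C \<Longrightarrow> T z - r *\<^sub>R y \<in> C"
    and r: "0 < r" and a: "0 < a" and x: "x \<in> interior C" "x - a *\<^sub>R y \<in> C"
  shows "(T ^^ k) x - (r ^ k * a) *\<^sub>R y \<in> C"
proof (induction k)
  case (Suc k)
  define q where "q = r ^ k * a"
  have q: "0 < q" using r a by (simp add: q_def)
  have Tk: "(T ^^ k) x \<in> interior C" using iterate_interior x by blast
  let ?z = "(1 / q) *\<^sub>R (T ^^ k) x"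
  have "(1 / q) *\<^sub>R ((T ^^ k) x - q *\<^sub>R y) \<in> C"
    using Suc q by (intro cone_scaleR[OF cone]) (auto simp: q_def)
  then have "?z - y \<in> C" using q by (simp add: scaleR_right_diff_distrib)
  moreover have zi: "?z \<in> interior C" using interior_cone_scaleR[OF cone Tk] q by simp
  ultimately have "T ?z - r *\<^sub>R y \<in> C" using sub by blast
  then have "q *\<^sub>R (T ?z - r *\<^sub>R y) \<in> C" using q by (intro cone_scaleR[OF cone]) auto
  moreover have "q *\<^sub>R T ?z = T ((T ^^ k) x)" using hom[of "1 / q"] Tk q by simp
  ultimately show ?case by (simp add: scaleR_right_diff_distrib q_def ac_simps)
qed (use x in simp)

lemma iterate_supersolution:
  assumes y: "y \<in> interior C" and l: "0 < l" and le: "l *\<^sub>R y - T y \<in> C"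
    and x: "x \<in> interior C"
  obtains c where "0 < c" "\<And>k. (c * l ^ k) *\<^sub>R x - (T ^^ k) x \<in> C"
proof -
  have up: "l ^ k *\<^sub>R y - (T ^^ k) y \<in> C" for k
  proof (induction k)
    case 0
    show ?case using cone_scaleR[OF cone, of y 0] y interior_subset by auto
  next
    case (Suc k)
    have "T (l ^ k *\<^sub>R y) - T ((T ^^ k) y) \<in> C"
      using map_mono iterate_interior y interior_cone_scaleR[OF cone y] l Suc by simp
    then have 1: "l ^ k *\<^sub>R T y - (T ^^ Suc k) y \<in> C" using hom y l by simp
    have "l ^ k *\<^sub>R (l *\<^sub>R y - T y) \<in> C" using cone_scaleR[OF cone le] l by simp
    from convex_cone_add[OF cone convex this 1] show ?case
      by (simp add: scaleR_right_diff_distrib mult.commute)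
  qed
  obtain a where a: "a > 0" "a *\<^sub>R y - x \<in> C"
    using interior_dominates[OF cone y, of x] unfolding cone_le_def by blast
  obtain b where b: "b > 0" "b *\<^sub>R x - y \<in> C"
    using interior_dominates[OF cone x, of y] unfolding cone_le_def by blast
  have "((a * b) * l ^ k) *\<^sub>R x - (T ^^ k) x \<in> C" for k
  proof -
    have "(T ^^ k) (a *\<^sub>R y) - (T ^^ k) x \<in> C"
      using iterate_mono[OF x interior_cone_scaleR[OF cone y a(1)] a(2)] .
    then have 1: "a *\<^sub>R (T ^^ k) y - (T ^^ k) x \<in> C" using iterate_hom y a by simp
    have 2: "a *\<^sub>R (l ^ k *\<^sub>R y - (T ^^ k) y) \<in> C" using cone_scaleR[OF cone up] a by simp
    have 3: "(a * l ^ k) *\<^sub>R (b *\<^sub>R x - y) \<in> C" using cone_scaleR[OF cone b(2)] a l by simp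
    from convex_cone_add[OF cone convex convex_cone_add[OF cone convex 1 2] 3]
    show ?thesis by (simp add: algebra_simps)
  qed
  moreover have "0 < a * b" using a b by simp
  ultimately show thesis using that by blast
qed

end

section \<open>Displacement and escape rate on a symmetric cone\<close>

lemma RFunk_le_ln:
  assumes "symmetric_cone C" "x \<in> interior C" "y \<in> interior C" "0 < l" "l *\<^sub>R x - y \<in> C"
  shows "RFunk C x y \<le> ln l"
proof -
  have "funk_M C y x \<le> l"
    unfolding funk_M_def using assms by (intro cInf_lower bdd_belowI[of _ 0]) (auto simp: cone_le_def)
  then show ?thesis
    unfolding RFunk_def using funk_M_pos(2)[OF assms(1-3)] assms(4) by simp
qed

lemma ln_le_RFunk:
  assumes "symmetric_cone C" "x \<in> interior C" "y \<in> interior C" "0 < m"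
    and "\<And>l. 0 < l \<Longrightarrow> l *\<^sub>R x - y \<in> C \<Longrightarrow> m \<le> l"
  shows "ln m \<le> RFunk C x y"
proof -
  have "m \<le> funk_M C y x"
    unfolding funk_M_def using funk_M_pos(1)[OF assms(1-3)] assms(5)
    by (intro cInf_greatest) (auto simp: cone_le_def)
  then show ?thesis unfolding RFunk_def using assms(4) by simp
qed

lemma RFunk_lessE:
  assumes "symmetric_cone C" "x \<in> interior C" "y \<in> interior C" "RFunk C x y < t"
  obtains l where "0 < l" "l *\<^sub>R x - y \<in> C" "ln l < t"
proof -
  have "\<not> exp t \<le> l \<Longrightarrow> 0 < l \<Longrightarrow> ln l < t" for l
    by (metis exp_less_cancel_iff exp_ln not_le)
  then show thesis
    using ln_le_RFunk[OF assms(1-3), of "exp t"] assms(4) that by fastforce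
qed

lemma symmetric_cone_imp_locale:
  assumes "symmetric_cone C" "T \<in> interior C \<rightarrow> interior C"
    and "monotone_on (interior C) (cone_le C) (cone_le C) T"
    and "\<And>l y. 0 < l \<Longrightarrow> y \<in> interior C \<Longrightarrow> T (l *\<^sub>R y) = l *\<^sub>R T y"
  shows "monotone_homogeneous_map C T"
  using assms unfolding symmetric_cone_def by unfold_locales auto

lemma rho_bar_le_supersolution:
  assumes S: "symmetric_cone C" and M: "monotone_homogeneous_map C T"
    and y: "y \<in> interior C" "0 < l" "l *\<^sub>R y - T y \<in> C"
  shows "exp (rho_bar C T) \<le> l"
proof -
  interpret monotone_homogeneous_map C T by (rule M)
  have "rho_bar C T \<le> RFunk C y (T y)"
    unfolding rho_bar_def
    using RFunk_displacement_bdd_below[OF S maps mono hom] y(1) by (rule cINF_lower)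
  also have "\<dots> \<le> ln l"
    using RFunk_le_ln[OF S y(1) map_interior[OF y(1)] y(2,3)] .
  finally show ?thesis using y(2) by (metis exp_le_cancel_iff exp_ln)
qed

text \<open>With \<open>m\<close> the maximal ratio of \<open>w \<bullet> y\<close> to \<open>w \<bullet> x\<close>, the vector \<open>y / m\<close> is the largest
  multiple of \<open>y\<close> below \<open>x\<close>, and \<open>v\<close> takes the same value on it as on \<open>x\<close>.\<close>

lemma extreme_ray_escape:
  fixes C :: "'a::euclidean_space set"
  assumes S: "symmetric_cone C" and M: "monotone_homogeneous_map C T" and x: "x \<in> interior C"
  obtains v where "v \<in> C" "v \<bullet> x = 1" "extreme_ray_of ((\<lambda>t. t *\<^sub>R v) ` {0..}) C"
    "\<And>k. exp (rho_bar C T) ^ k \<le> v \<bullet> (T ^^ k) x"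
proof -
  interpret monotone_homogeneous_map C T by (rule M)
  have dual: "dual_cone C = C" using S unfolding symmetric_cone_def by blast
  have xd: "x \<in> interior (dual_cone C)" using x dual by simp
  define r where "r = exp (rho_bar C T)"
  have r: "0 < r" by (simp add: r_def)
  obtain y where y: "y \<in> C" "y \<noteq> 0"
    and sub: "\<And>z. z \<in> interior C \<Longrightarrow> z - y \<in> C \<Longrightarrow> T z - r *\<^sub>R y \<in> C"
    using subeigenvector_exists[OF xd x, of r] rho_bar_le_supersolution[OF S M]
    unfolding r_def by metis
  obtain v where v: "v \<in> C" "v \<bullet> x = 1" "extreme_ray_of ((\<lambda>t. t *\<^sub>R v) ` {0..}) C"
    and vmax: "\<And>w. w \<in> C \<Longrightarrow> w \<bullet> y \<le> (v \<bullet> y) * (w \<bullet> x)"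
    using extreme_ray_maximizing_ratio[OF cone convex closed _ xd, of y] y by blast
  define m where "m = v \<bullet> y"
  have "0 < y \<bullet> x" by (rule inner_interior_dual_pos[OF xd y])
  moreover have "0 < y \<bullet> y" using y by simp
  ultimately have m: "0 < m" using vmax[OF y(1)] unfolding m_def
    by (metis less_le_trans zero_less_mult_pos2)
  \<comment> \<open>The bipolar theorem is immediate here: the cone is its own dual.\<close>
  have "x - (1 / m) *\<^sub>R y \<in> dual_cone C"
    unfolding dual_cone_def
  proof (clarify)
    fix w assume "w \<in> C"
    from vmax[OF this] show "0 \<le> (x - (1 / m) *\<^sub>R y) \<bullet> w"
      using m by (simp add: m_def[symmetric] inner_diff_right inner_commute[of _ w] field_simps)
  qed
  then have "x - (1 / m) *\<^sub>R y \<in> C" by (simp add: dual)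
  then have k: "(T ^^ k) x - (r ^ k * (1 / m)) *\<^sub>R y \<in> dual_cone C" for k
    using iterate_subeigenvector[OF sub r _ x, of "1 / m"] m dual by simp
  have "r ^ k \<le> v \<bullet> (T ^^ k) x" for k
  proof -
    have "0 \<le> ((T ^^ k) x - (r ^ k * (1 / m)) *\<^sub>R y) \<bullet> v"
      using k v(1) unfolding dual_cone_def by blast
    also have "\<dots> = v \<bullet> (T ^^ k) x - r ^ k"
      using m by (simp add: inner_diff_right inner_commute[of _ v] m_def[symmetric])
    finally show ?thesis by simp
  qed
  then show thesis using that v unfolding r_def by blast
qed

text \<open>The lower bound holds for each \<open>k\<close>, by pairing with the extreme vector of the previous
  lemma. The upper bound uses a supersolution with factor \<open>l\<close> as close to the infimum as
  desired; its constant \<open>c\<close> disappears after division by \<open>k\<close>.\<close>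

lemma escape_rate_limit:
  fixes C :: "'a::euclidean_space set"
  assumes S: "symmetric_cone C" and M: "monotone_homogeneous_map C T" and x: "x \<in> interior C"
  shows "(\<lambda>k. RFunk C x ((T ^^ k) x) / real k) \<longlonglongrightarrow> rho_bar C T"
proof -
  interpret monotone_homogeneous_map C T by (rule M)
  have dual: "dual_cone C = C" using S unfolding symmetric_cone_def by blast
  obtain v where v: "v \<in> C" "v \<bullet> x = 1" "\<And>k. exp (rho_bar C T) ^ k \<le> v \<bullet> (T ^^ k) x"
    using extreme_ray_escape[OF S M x] by blast
  have Tk: "(T ^^ k) x \<in> interior C" for k using iterate_interior x by blast
  have lower: "real k * rho_bar C T \<le> RFunk C x ((T ^^ k) x)" for k
  proof -
    have "exp (rho_bar C T) ^ k \<le> l" if "l *\<^sub>R x - (T ^^ k) x \<in> C" for l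
    proof -
      have "0 \<le> v \<bullet> (l *\<^sub>R x - (T ^^ k) x)"
        using v(1) that dual unfolding dual_cone_def by blast
      then show ?thesis using v(2) v(3)[of k] by (simp add: inner_diff_right)
    qed
    then have "ln (exp (rho_bar C T) ^ k) \<le> RFunk C x ((T ^^ k) x)"
      by (intro ln_le_RFunk[OF S x Tk]) auto
    then show ?thesis by (simp add: ln_realpow)
  qed
  show ?thesis
  proof (rule order_tendstoI)
    fix a assume a: "a < rho_bar C T"
    show "\<forall>\<^sub>F k in sequentially. a < RFunk C x ((T ^^ k) x) / real k"
      using eventually_gt_at_top[of 0]
    proof eventually_elim
      case (elim k)
      then have "rho_bar C T \<le> RFunk C x ((T ^^ k) x) / real k"
        using lower[of k] by (simp add: field_simps)
      with a show ?case by simp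
    qed
  next
    fix a assume "rho_bar C T < a"
    then obtain y where y: "y \<in> interior C" "RFunk C y (T y) < a"
      unfolding rho_bar_def using x
      by (metis (no_types, lifting) cINF_less_iff RFunk_displacement_bdd_below[OF S maps mono hom]
          empty_iff)
    obtain l where l: "0 < l" "l *\<^sub>R y - T y \<in> C" "ln l < a"
      using RFunk_lessE[OF S y(1) map_interior[OF y(1)] y(2)] .
    obtain c where c: "0 < c" "\<And>k. (c * l ^ k) *\<^sub>R x - (T ^^ k) x \<in> C"
      using iterate_supersolution[OF y(1) l(1,2) x] by blast
    have upper: "RFunk C x ((T ^^ k) x) \<le> ln c + real k * ln l" for k
      using RFunk_le_ln[OF S x Tk _ c(2)] c(1) l(1) by (simp add: ln_mult ln_realpow)
    have "(\<lambda>k. ln c * (1 / real k) + ln l) \<longlonglongrightarrow> ln c * 0 + ln l"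
      by (intro tendsto_intros lim_1_over_n)
    then have "\<forall>\<^sub>F k in sequentially. ln c * (1 / real k) + ln l < a"
      using l(3) by (auto intro: order_tendstoD)
    then show "\<forall>\<^sub>F k in sequentially. RFunk C x ((T ^^ k) x) / real k < a"
      using eventually_gt_at_top[of 0]
    proof eventually_elim
      case (elim k)
      then have "RFunk C x ((T ^^ k) x) / real k \<le> ln c * (1 / real k) + ln l"
        using upper[of k] by (simp add: field_simps)
      with elim show ?case by simp
    qed
  qed
qed

theorem corollary32:
  fixes C :: "'a::euclidean_space set" and T :: "'a \<Rightarrow> 'a"
  assumes "symmetric_cone C"
    and "T \<in> interior C \<rightarrow> interior C"
    and "monotone_on (interior C) (cone_le C) (cone_le C) T"
    and "\<And>l y. 0 < l \<Longrightarrow> y \<in> interior C \<Longrightarrow> T (l *\<^sub>R y) = l *\<^sub>R T y"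
  shows "\<forall>x\<in>interior C.
    ((\<lambda>k. RFunk C x ((T ^^ k) x) / real k) \<longlonglongrightarrow> rho_bar C T) \<and>
    (\<exists>R. extreme_ray_of R C \<and>
      (\<forall>w\<in>R - {0}. \<forall>k.
        ln (w \<bullet> (T ^^ k) x) \<ge> ln (w \<bullet> x) + real k * rho_bar C T))"
proof (intro ballI conjI)
  fix x assume x: "x \<in> interior C"
  have M: "monotone_homogeneous_map C T" by (rule symmetric_cone_imp_locale[OF assms])
  show "(\<lambda>k. RFunk C x ((T ^^ k) x) / real k) \<longlonglongrightarrow> rho_bar C T"
    by (rule escape_rate_limit[OF assms(1) M x])
  obtain v where v: "v \<bullet> x = 1" "extreme_ray_of ((\<lambda>t. t *\<^sub>R v) ` {0..}) C"
    "\<And>k. exp (rho_bar C T) ^ k \<le> v \<bullet> (T ^^ k) x"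
    using extreme_ray_escape[OF assms(1) M x] by blast
  have "ln (w \<bullet> x) + real k * rho_bar C T \<le> ln (w \<bullet> (T ^^ k) x)"
    if w: "w \<in> (\<lambda>t. t *\<^sub>R v) ` {0..} - {0}" for w k
  proof -
    obtain t where t: "w = t *\<^sub>R v" "0 \<le> t" using w by auto
    then have "0 < t" using w by (cases "t = 0") auto
    have "ln t + real k * rho_bar C T = ln (t * exp (rho_bar C T) ^ k)"
      using \<open>0 < t\<close> by (simp add: ln_mult ln_realpow)
    also have "\<dots> \<le> ln (t * (v \<bullet> (T ^^ k) x))"
      using \<open>0 < t\<close> v(3)[of k] by (intro ln_mono mult_left_mono) auto
    finally show ?thesis using t v(1) by simp
  qed
  with v(2) show "\<exists>R. extreme_ray_of R C \<and>
      (\<forall>w\<in>R - {0}. \<forall>k. ln (w \<bullet> (T ^^ k) x) \<ge> ln (w \<bullet> x) + real k * rho_bar C T)"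
    by blast
qed

end
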